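(* Let $G$ be a countable infinite residually finite group, let $(\Gamma_n)_{n\in\mathbb{N}}$ be a scale of $G$, and let $X=G_{(\Gamma_n)}$ be the associated free exact odometer. Then, as subgroups of $\mathrm{Homeo}(X)$, $$\mathrm{Aut}^\infty(X,\alpha_X,G)=\bigcup_{n\in\mathbb{N}}\mathrm{Aut}(X,\alpha_X|_{\Gamma_n},\Gamma_n)=\bigcup_{n\in\mathbb{N}}\overline{[[\beta_X]]_n}=[[R_X]],$$ where the closures are taken with respect to the topology of uniform convergence in $\mathrm{Homeo}(X)$.
   Context: A scale of a countable group $G$ is a decreasing sequence $(\Gamma_n)_{n\in\mathbb{N}}$ of normal finite-index subgroups of $G$ with $\bigcap_n\Gamma_n=\{1_G\}$. The associated free exact odometer is $X=G_{(\Gamma_n)}=\{(x_n)_n\in\prod_n G/\Gamma_n : x_{n+1}\mapsto x_n \text{ under } G/\Gamma_{n+1}\to G/\Gamma_n \text{ for all } n\}$, a subgroup of the product group with the topology induced by the product of the discrete topologies (metrized by $d(x,y)=2^{-\min\{n:x_n\ne y_n\}}$ for $x\neq y$). Let $\tau:G\to X$, $\tau(g)=(g\Gamma_n)_n$. The left and right odometer actions of $G$ on $X$ are $\alpha_X^g(x)=\tau(g)x$ and $\beta_X^g(x)=x\tau(g)^{-1}$. For $a\in G/\Gamma_n$, $[a]_n=\{x\in X: x_n=a\}$ is the corresponding cylinder set of level $n$. The action $R_X$ of the group $X$ on the space $X$ is $R_X^{\xi}(x)=x\xi^{-1}$. For an action $\alpha$ of a (not necessarily countable) group $K$ by homeomorphisms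 on a compact totally disconnected metrizable space $Z$, the topological full group $[[\alpha]]$ is the group of all homeomorphisms $f$ of $Z$ for which there exist a finite clopen partition $\{A_1,\dots,A_k\}$ of $Z$ and $g_1,\dots,g_k\in K$ with $f(y)=\alpha^{g_i}(y)$ for all $y\in A_i$. The set $[[\beta_X]]_n$ consists of those $f\in[[\beta_X]]$ such that for every $a\in G/\Gamma_n$ there is $g_a\in G$ with $f(x)=\beta_X^{g_a}(x)$ for all $x\in[a]_n$. For an action $\alpha$ of a group $G$ on $X$ by homeomorphisms, $\mathrm{Aut}(X,\alpha,G)$ is the group of homeomorphisms $f$ of $X$ with $f\circ\alpha^g=\alpha^g\circ f$ for all $g\in G$. The stabilized automorphism group is $\mathrm{Aut}^\infty(X,\alpha,G)=\bigcup_{H}\mathrm{Aut}(X,\alpha|_H,H)$, the union over all finite-index subgroups $H$ of $G$, where $\alpha|_H$ is the restriction of the action to $H$. *)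

theory Defs
  imports
    "HOL-Analysis.Analysis"
    "HOL-Algebra.Product_Groups"
    "HOL-Algebra.Bij"
begin

section \<open>Scales and residual finiteness\<close>

definition finite_index_subgroup :: "'a set \<Rightarrow> ('a, 'b) monoid_scheme \<Rightarrow> bool" where
  "finite_index_subgroup H G \<longleftrightarrow> subgroup H G \<and> finite (rcosets\<^bsub>G\<^esub> H)"

definition residually_finite :: "('a, 'b) monoid_scheme \<Rightarrow> bool" where
  "residually_finite G \<longleftrightarrow>
     (\<forall>g\<in>carrier G. g \<noteq> \<one>\<^bsub>G\<^esub> \<longrightarrow>
        (\<exists>N. N \<lhd> G \<and> finite_index_subgroup N G \<and> g \<notin> N))"

definition scale :: "('a, 'b) monoid_scheme \<Rightarrow> (nat \<Rightarrow> 'a set) \<Rightarrow> bool" where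
  "scale G \<Gamma> \<longleftrightarrow>
     (\<forall>n. \<Gamma> n \<lhd> G \<and> finite_index_subgroup (\<Gamma> n) G) \<and>
     (\<forall>n. \<Gamma> (Suc n) \<subseteq> \<Gamma> n) \<and>
     (\<Inter>n. \<Gamma> n) = {\<one>\<^bsub>G\<^esub>}"


section \<open>The odometer\<close>

text \<open>The library builds the quotient \<open>G Mod \<Gamma> n\<close> from right cosets; the subgroups of a scale are
  normal, so these are the left cosets \<open>g \<Gamma>\<^sub>n\<close>. The compatibility condition says that the pair
  \<open>(x (Suc n), x n)\<close> lies on the graph of the canonical map from \<open>G Mod \<Gamma> (Suc n)\<close> to
  \<open>G Mod \<Gamma> n\<close>.\<close>

definition odometer_set :: "('a, 'b) monoid_scheme \<Rightarrow> (nat \<Rightarrow> 'a set) \<Rightarrow> (nat \<Rightarrow> 'a set) set" where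
  "odometer_set G \<Gamma> =
     {x \<in> carrier (product_group UNIV (\<lambda>n. G Mod \<Gamma> n)).
        \<forall>n. \<exists>g\<in>carrier G. x (Suc n) = \<Gamma> (Suc n) #>\<^bsub>G\<^esub> g \<and> x n = \<Gamma> n #>\<^bsub>G\<^esub> g}"

definition odometer :: "('a, 'b) monoid_scheme \<Rightarrow> (nat \<Rightarrow> 'a set) \<Rightarrow> (nat \<Rightarrow> 'a set) monoid" where
  "odometer G \<Gamma> = (product_group UNIV (\<lambda>n. G Mod \<Gamma> n))\<lparr>carrier := odometer_set G \<Gamma>\<rparr>"

definition odometer_topology ::
  "('a, 'b) monoid_scheme \<Rightarrow> (nat \<Rightarrow> 'a set) \<Rightarrow> (nat \<Rightarrow> 'a set) topology" where
  "odometer_topology G \<Gamma> =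
     subtopology (product_topology (\<lambda>n. discrete_topology (carrier (G Mod \<Gamma> n))) UNIV)
       (odometer_set G \<Gamma>)"

definition odometer_dist :: "(nat \<Rightarrow> 'a set) \<Rightarrow> (nat \<Rightarrow> 'a set) \<Rightarrow> real" where
  "odometer_dist x y = (if x = y then 0 else (1/2) ^ (LEAST n. x n \<noteq> y n))"

definition odometer_metric ::
  "('a, 'b) monoid_scheme \<Rightarrow> (nat \<Rightarrow> 'a set) \<Rightarrow> (nat \<Rightarrow> 'a set) metric" where
  "odometer_metric G \<Gamma> = metric (odometer_set G \<Gamma>, odometer_dist)"

definition odometer_emb :: "('a, 'b) monoid_scheme \<Rightarrow> (nat \<Rightarrow> 'a set) \<Rightarrow> 'a \<Rightarrow> (nat \<Rightarrow> 'a set)" where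
  "odometer_emb G \<Gamma> g = (\<lambda>n. \<Gamma> n #>\<^bsub>G\<^esub> g)"

definition cylinder ::
  "('a, 'b) monoid_scheme \<Rightarrow> (nat \<Rightarrow> 'a set) \<Rightarrow> nat \<Rightarrow> 'a set \<Rightarrow> (nat \<Rightarrow> 'a set) set" where
  "cylinder G \<Gamma> n a = {x \<in> odometer_set G \<Gamma>. x n = a}"

definition left_action ::
  "('a, 'b) monoid_scheme \<Rightarrow> (nat \<Rightarrow> 'a set) \<Rightarrow> 'a \<Rightarrow> (nat \<Rightarrow> 'a set) \<Rightarrow> (nat \<Rightarrow> 'a set)" where
  "left_action G \<Gamma> g =
     (\<lambda>x\<in>odometer_set G \<Gamma>. odometer_emb G \<Gamma> g \<otimes>\<^bsub>odometer G \<Gamma>\<^esub> x)"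

definition right_action ::
  "('a, 'b) monoid_scheme \<Rightarrow> (nat \<Rightarrow> 'a set) \<Rightarrow> 'a \<Rightarrow> (nat \<Rightarrow> 'a set) \<Rightarrow> (nat \<Rightarrow> 'a set)" where
  "right_action G \<Gamma> g =
     (\<lambda>x\<in>odometer_set G \<Gamma>. x \<otimes>\<^bsub>odometer G \<Gamma>\<^esub> inv\<^bsub>odometer G \<Gamma>\<^esub> (odometer_emb G \<Gamma> g))"

definition right_translation ::
  "('a, 'b) monoid_scheme \<Rightarrow> (nat \<Rightarrow> 'a set) \<Rightarrow>
     (nat \<Rightarrow> 'a set) \<Rightarrow> (nat \<Rightarrow> 'a set) \<Rightarrow> (nat \<Rightarrow> 'a set)" where
  "right_translation G \<Gamma> \<xi> =
     (\<lambda>x\<in>odometer_set G \<Gamma>. x \<otimes>\<^bsub>odometer G \<Gamma>\<^esub> inv\<^bsub>odometer G \<Gamma>\<^esub> \<xi>)"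


section \<open>Homeomorphism groups, full groups and automorphism groups\<close>

text \<open>Self-maps of a space are represented, as in \<^const>\<open>BijGroup\<close>, by functions that are
  \<^const>\<open>undefined\<close> outside the space, so that equality of maps is equality of functions.\<close>

definition Homeo :: "'z topology \<Rightarrow> ('z \<Rightarrow> 'z) set" where
  "Homeo Z = {f \<in> extensional (topspace Z). homeomorphic_map Z Z f}"

definition HomeoGroup :: "'z topology \<Rightarrow> ('z \<Rightarrow> 'z) monoid" where
  "HomeoGroup Z = BijGroup (topspace Z) \<lparr>carrier := Homeo Z\<rparr>"

text \<open>Topology of uniform convergence on \<^term>\<open>Homeo Z\<close> for a bounded metric \<open>m\<close> inducing
  \<open>Z\<close>: \<^const>\<open>funspace\<close> carries the supremum metric.\<close>

definition uniform_topology :: "'z topology \<Rightarrow> 'z metric \<Rightarrow> ('z \<Rightarrow> 'z) topology" where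
  "uniform_topology Z m = subtopology (mtopology_of (funspace (topspace Z) m)) (Homeo Z)"

definition topological_full_group ::
  "'z topology \<Rightarrow> ('k, 'b) monoid_scheme \<Rightarrow> ('k \<Rightarrow> 'z \<Rightarrow> 'z) \<Rightarrow> ('z \<Rightarrow> 'z) set" where
  "topological_full_group Z K \<alpha> =
     {f \<in> Homeo Z. \<exists>P. finite P \<and> partition_on (topspace Z) P \<and>
        (\<forall>A\<in>P. openin Z A \<and> closedin Z A \<and> (\<exists>g\<in>carrier K. \<forall>y\<in>A. f y = \<alpha> g y))}"

definition Aut :: "'z topology \<Rightarrow> ('k, 'b) monoid_scheme \<Rightarrow> ('k \<Rightarrow> 'z \<Rightarrow> 'z) \<Rightarrow> ('z \<Rightarrow> 'z) set" where
  "Aut Z K \<alpha> = {f \<in> Homeo Z. \<forall>g\<in>carrier K. \<forall>z\<in>topspace Z. f (\<alpha> g z) = \<alpha> g (f z)}"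

definition stabilized_Aut ::
  "'z topology \<Rightarrow> ('k, 'b) monoid_scheme \<Rightarrow> ('k \<Rightarrow> 'z \<Rightarrow> 'z) \<Rightarrow> ('z \<Rightarrow> 'z) set" where
  "stabilized_Aut Z K \<alpha> = (\<Union>H\<in>{H. finite_index_subgroup H K}. Aut Z (K\<lparr>carrier := H\<rparr>) \<alpha>)"

definition right_full_group_level ::
  "('a, 'b) monoid_scheme \<Rightarrow> (nat \<Rightarrow> 'a set) \<Rightarrow> nat \<Rightarrow> ((nat \<Rightarrow> 'a set) \<Rightarrow> (nat \<Rightarrow> 'a set)) set" where
  "right_full_group_level G \<Gamma> n =
     {f \<in> topological_full_group (odometer_topology G \<Gamma>) G (right_action G \<Gamma>).
        \<forall>a\<in>carrier (G Mod \<Gamma> n). \<exists>g\<in>carrier G. \<forall>x\<in>cylinder G \<Gamma> n a. f x = right_action G \<Gamma> g x}"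


section \<open>Well-definedness of the metric\<close>

lemma Metric_space_odometer: "Metric_space (odometer_set G \<Gamma>) odometer_dist"
proof
  show "0 \<le> odometer_dist x y" for x y :: "nat \<Rightarrow> 'a set"
    by (simp add: odometer_dist_def)
  show "odometer_dist x y = odometer_dist y x" for x y :: "nat \<Rightarrow> 'a set"
    unfolding odometer_dist_def eq_commute[of x y] eq_commute[of "x _" "y _"] by (rule refl)
  show "odometer_dist x y = 0 \<longleftrightarrow> x = y" for x y :: "nat \<Rightarrow> 'a set"
    by (simp add: odometer_dist_def)
  show "odometer_dist x z \<le> odometer_dist x y + odometer_dist y z" for x y z :: "nat \<Rightarrow> 'a set"
  proof (cases "x = y \<or> y = z \<or> x = z")
    case True
    then show ?thesis by (auto simp: odometer_dist_def)
  next
    case False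
    define k where "k = (LEAST n. x n \<noteq> z n)"
    have "x k \<noteq> z k"
      unfolding k_def by (rule LeastI_ex) (use False in \<open>auto simp: fun_eq_iff\<close>)
    then consider "x k \<noteq> y k" | "y k \<noteq> z k" by auto
    then have "(LEAST n. x n \<noteq> y n) \<le> k \<or> (LEAST n. y n \<noteq> z n) \<le> k"
      by cases (auto intro: Least_le)
    then have "(1/2::real) ^ k \<le> (1/2) ^ (LEAST n. x n \<noteq> y n) \<or>
               (1/2::real) ^ k \<le> (1/2) ^ (LEAST n. y n \<noteq> z n)"
      by (auto intro: power_decreasing)
    moreover have "(0::real) \<le> (1/2) ^ (LEAST n. x n \<noteq> y n)" "(0::real) \<le> (1/2) ^ (LEAST n. y n \<noteq> z n)"
      by auto
    ultimately have "(1/2::real) ^ k \<le> (1/2) ^ (LEAST n. x n \<noteq> y n) + (1/2) ^ (LEAST n. y n \<noteq> z n)"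
      by linarith
    then show ?thesis using False by (simp add: odometer_dist_def k_def)
  qed
qed

lemma topspace_odometer_topology: "topspace (odometer_topology G \<Gamma>) = odometer_set G \<Gamma>"
  by (auto simp: odometer_topology_def odometer_set_def product_group_def)

end

theory Submission
  imports Defs
begin

text \<open>A homeomorphism commuting with left translation by \<open>H\<close> commutes, by continuity, with left
  translation by the closure of \<open>\<tau>(H)\<close> in the odometer. If \<open>H\<close> has finite index, then this closure
  contains \<open>\<tau>(\<Gamma>\<^sub>N)\<close> for some \<open>N\<close>. The closure of \<open>\<tau>(\<Gamma>\<^sub>n)\<close> is the cylinder of the identity at level
  \<open>n\<close>, so the homeomorphisms commuting with \<open>\<Gamma>\<^sub>n\<close> are precisely those that act on each cylinder of
  level \<open>n\<close> as a right translation. By compactness every element of the full group of right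
  translations is of this form for some \<open>n\<close>, and replacing the translating elements by elements of
  \<open>\<tau>(G)\<close> that agree with them up to level \<open>m \<ge> n\<close> approximates it by elements of the full group of
  the right action.\<close>

section \<open>Homeomorphism groups and automorphism groups as subgroups\<close>

text \<open>\<open>BijGroup\<close> composes and inverts by restricted versions of the usual
  operations. These agree on the space with the composite and the inverse homeomorphism, and
  \<open>homeomorphic_map_eq\<close> transfers the property.\<close>

lemma subgroup_Homeo: "subgroup (Homeo Z) (BijGroup (topspace Z))"
proof (rule subgroup.intro)
  show sub: "Homeo Z \<subseteq> carrier (BijGroup (topspace Z))"
    by (auto simp: Homeo_def BijGroup_def Bij_def bij_betw_def homeomorphic_eq_everything_map)
  have "homeomorphic_map Z Z (\<lambda>x\<in>topspace Z. x)"
    by (rule homeomorphic_map_eq[of _ _ id]) auto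
  then show "\<one>\<^bsub>BijGroup (topspace Z)\<^esub> \<in> Homeo Z"
    by (simp add: Homeo_def BijGroup_def)
  fix f assume f: "f \<in> Homeo Z"
  then have fB: "f \<in> Bij (topspace Z)" using sub by (auto simp: BijGroup_def)
  obtain g where g: "homeomorphic_maps Z Z f g"
    using f by (auto simp: Homeo_def homeomorphic_map_maps)
  have "inv_into (topspace Z) f y = g y" if "y \<in> topspace Z" for y
  proof (rule inv_into_f_eq)
    show "inj_on f (topspace Z)" using fB by (simp add: Bij_def bij_betw_def)
    show "g y \<in> topspace Z" "f (g y) = y"
      using g that by (auto simp: homeomorphic_maps_def continuous_map_def)
  qed
  moreover have "homeomorphic_map Z Z g" using g homeomorphic_maps_map by blast
  ultimately have "homeomorphic_map Z Z (\<lambda>y\<in>topspace Z. inv_into (topspace Z) f y)"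
    by (metis (no_types, lifting) homeomorphic_map_eq restrict_apply')
  then show "inv\<^bsub>BijGroup (topspace Z)\<^esub> f \<in> Homeo Z"
    by (simp add: inv_BijGroup[OF fB] Homeo_def)
  fix g assume g: "g \<in> Homeo Z"
  then have gB: "g \<in> Bij (topspace Z)" using sub by (auto simp: BijGroup_def)
  have "homeomorphic_map Z Z (f \<circ> g)"
    using f g homeomorphic_map_compose[of Z Z g Z f] by (simp add: Homeo_def)
  then have "homeomorphic_map Z Z (compose (topspace Z) f g)"
    by (rule homeomorphic_map_eq) (simp add: compose_def)
  then show "f \<otimes>\<^bsub>BijGroup (topspace Z)\<^esub> g \<in> Homeo Z"
    using fB gB by (simp add: BijGroup_def Homeo_def)
qed

text \<open>Closure under inverses comes from reading
  \<open>f (\<alpha> g w) = \<alpha> g (f w)\<close> backwards. The assumption keeps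
  \<open>\<alpha> g z\<close> in the space, where restricted maps are meaningful.\<close>

lemma subgroup_Aut:
  assumes \<alpha>: "\<And>g z. g \<in> carrier K \<Longrightarrow> z \<in> topspace Z \<Longrightarrow> \<alpha> g z \<in> topspace Z"
  shows "subgroup (Aut Z K \<alpha>) (HomeoGroup Z)"
proof -
  interpret B: group "BijGroup (topspace Z)" by (rule group_BijGroup)
  have Bij: "f \<in> Bij (topspace Z)" if "f \<in> Homeo Z" for f
    using subgroup.subset[OF subgroup_Homeo[of Z]] that by (auto simp: BijGroup_def)
  have maps: "f z \<in> topspace Z" if "f \<in> Homeo Z" "z \<in> topspace Z" for f z
    using Bij_imp_funcset[OF Bij] that by blast
  show ?thesis
  proof (rule subgroup.intro)
    show "Aut Z K \<alpha> \<subseteq> carrier (HomeoGroup Z)" by (auto simp: Aut_def HomeoGroup_def)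
    show "\<one>\<^bsub>HomeoGroup Z\<^esub> \<in> Aut Z K \<alpha>"
      using subgroup.one_closed[OF subgroup_Homeo[of Z]] \<alpha>
      by (auto simp: Aut_def HomeoGroup_def BijGroup_def)
  next
    fix f g assume f: "f \<in> Aut Z K \<alpha>" and g: "g \<in> Aut Z K \<alpha>"
    then have fg: "f \<in> Homeo Z" "g \<in> Homeo Z" by (auto simp: Aut_def)
    have eq: "f \<otimes>\<^bsub>HomeoGroup Z\<^esub> g = compose (topspace Z) f g"
      using fg Bij by (simp add: HomeoGroup_def BijGroup_def)
    have "f \<otimes>\<^bsub>HomeoGroup Z\<^esub> g \<in> Homeo Z"
      using subgroup.m_closed[OF subgroup_Homeo fg] by (simp add: HomeoGroup_def)
    then show "f \<otimes>\<^bsub>HomeoGroup Z\<^esub> g \<in> Aut Z K \<alpha>"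
      using f g \<alpha> maps fg by (simp add: Aut_def eq compose_def)
  next
    fix f assume f: "f \<in> Aut Z K \<alpha>"
    then have fH: "f \<in> Homeo Z" by (auto simp: Aut_def)
    have eq: "inv\<^bsub>HomeoGroup Z\<^esub> f = (\<lambda>x\<in>topspace Z. inv_into (topspace Z) f x)"
      using B.m_inv_consistent[OF subgroup_Homeo fH] inv_BijGroup[OF Bij[OF fH]]
      by (simp add: HomeoGroup_def)
    have "inv_into (topspace Z) f (\<alpha> g z) = \<alpha> g (inv_into (topspace Z) f z)"
      if g: "g \<in> carrier K" and z: "z \<in> topspace Z" for g z
    proof -
      have bij: "bij_betw f (topspace Z) (topspace Z)" using Bij[OF fH] by (simp add: Bij_def)
      then obtain w where w: "w \<in> topspace Z" "z = f w" using z by (auto simp: bij_betw_def)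
      have "\<alpha> g z = f (\<alpha> g w)" using f g w by (simp add: Aut_def)
      then show ?thesis
        using bij w \<alpha>[OF g w(1)] by (simp add: bij_betw_inv_into_left)
    qed
    moreover have "inv\<^bsub>HomeoGroup Z\<^esub> f \<in> Homeo Z"
      using subgroup.m_inv_closed[OF subgroup_Homeo fH] B.m_inv_consistent[OF subgroup_Homeo fH]
      by (simp add: HomeoGroup_def)
    ultimately show "inv\<^bsub>HomeoGroup Z\<^esub> f \<in> Aut Z K \<alpha>"
      using \<alpha> by (simp add: Aut_def eq)
  qed
qed

lemma subgroup_UN_incseq:
  assumes sub: "\<And>n. subgroup (A n) G" and mono: "incseq A"
  shows "subgroup (\<Union>n. A n) G"
proof (rule subgroup.intro)
  fix x y assume "x \<in> (\<Union>n. A n)" "y \<in> (\<Union>n. A n)"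
  then obtain m n where "x \<in> A m" "y \<in> A n" by auto
  then have "x \<in> A (max m n)" "y \<in> A (max m n)"
    using monoD[OF mono, of m "max m n"] monoD[OF mono, of n "max m n"] by auto
  then show "x \<otimes>\<^bsub>G\<^esub> y \<in> (\<Union>n. A n)"
    using subgroup.m_closed[OF sub] by blast
qed (use subgroup.subset[OF sub] subgroup.one_closed[OF sub] subgroup.m_inv_closed[OF sub] in \<open>blast+\<close>)

section \<open>The odometer as a group\<close>

locale scaled_group = group G for G :: "('a, 'b) monoid_scheme" (structure) +
  fixes \<Gamma> :: "nat \<Rightarrow> 'a set"
  assumes scale: "scale G \<Gamma>"
begin

abbreviation D where "D \<equiv> odometer G \<Gamma>"
abbreviation X where "X \<equiv> odometer_topology G \<Gamma>"
abbreviation emb where "emb \<equiv> odometer_emb G \<Gamma>"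

lemma normal_level: "\<Gamma> n \<lhd> G"
  using scale by (simp add: scale_def)

lemma subgroup_level: "subgroup (\<Gamma> n) G"
  using normal_level by (rule normal_imp_subgroup)

lemma group_level: "group (G Mod \<Gamma> n)"
  using normal_level by (rule normal.factorgroup_is_group)

lemma finite_level: "finite (carrier (G Mod \<Gamma> n))"
  using scale by (simp add: scale_def finite_index_subgroup_def FactGroup_def)

lemma level_antimono: "m \<le> n \<Longrightarrow> \<Gamma> n \<subseteq> \<Gamma> m"
  using scale lift_Suc_antimono_le[of \<Gamma> m n] by (simp add: scale_def)

text \<open>This is the well-definedness of the canonical projection from level \<open>n\<close> to
  level \<open>m\<close>.\<close>

lemma coset_eq_mono:
  assumes "m \<le> n" "g \<in> carrier G" "h \<in> carrier G" "\<Gamma> n #> g = \<Gamma> n #> h"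
  shows "\<Gamma> m #> g = \<Gamma> m #> h"
proof -
  have "h \<in> \<Gamma> n #> g"
    using assms subgroup_level by (intro repr_independenceD) auto
  then have "h \<in> \<Gamma> m #> g"
    using level_antimono[OF assms(1)] by (auto simp: r_coset_def)
  then show ?thesis
    using assms subgroup_level by (intro repr_independence) auto
qed

lemma odometer_set_compatible:
  assumes "x \<in> odometer_set G \<Gamma>"
  obtains g where "g \<in> carrier G" "x (Suc n) = \<Gamma> (Suc n) #> g" "x n = \<Gamma> n #> g"
  using assms unfolding odometer_set_def by blast

text \<open>The definition supplies a representative only for each pair of adjacent levels. By
  \<open>coset_eq_mono\<close>, the one for levels \<open>n\<close> and \<open>Suc n\<close> also
  represents every lower coordinate, so the induction can discard the old representative.\<close>

lemma odometer_setD: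
  assumes "x \<in> odometer_set G \<Gamma>"
  obtains g where "g \<in> carrier G" "\<And>m. m \<le> n \<Longrightarrow> x m = \<Gamma> m #> g"
proof -
  have "\<exists>g\<in>carrier G. \<forall>m\<le>n. x m = \<Gamma> m #> g"
  proof (induction n)
    case 0
    have "x 0 \<in> carrier (G Mod \<Gamma> 0)" using assms by (auto simp: odometer_set_def)
    then show ?case by (auto simp: carrier_FactGroup)
  next
    case (Suc n)
    then obtain g where g: "g \<in> carrier G" "\<And>m. m \<le> n \<Longrightarrow> x m = \<Gamma> m #> g" by blast
    obtain h where h: "h \<in> carrier G" "x (Suc n) = \<Gamma> (Suc n) #> h" "x n = \<Gamma> n #> h"
      using odometer_set_compatible[OF assms] .
    have "x m = \<Gamma> m #> h" if "m \<le> Suc n" for m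
    proof (cases "m = Suc n")
      case False
      with that have "m \<le> n" by simp
      moreover have "\<Gamma> n #> g = \<Gamma> n #> h" using g(2)[of n] h(3) by simp
      ultimately show ?thesis using g(2)[of m] coset_eq_mono[of m n g h] g(1) h(1) by simp
    qed (use h in simp)
    then show ?case using h by blast
  qed
  then show thesis using that by blast
qed

lemma level_mem: "x \<in> odometer_set G \<Gamma> \<Longrightarrow> x n \<in> carrier (G Mod \<Gamma> n)"
  by (auto simp: odometer_set_def)

text \<open>This allows agreement of two points up to level \<open>n\<close> to be expressed by the
  single equation \<open>x n = y n\<close>.\<close>

lemma odometer_prefix:
  assumes "x \<in> odometer_set G \<Gamma>" "y \<in> odometer_set G \<Gamma>" "x n = y n" "m \<le> n"
  shows "x m = y m"
proof -
  obtain g where "g \<in> carrier G" "\<And>m. m \<le> n \<Longrightarrow> x m = \<Gamma> m #> g"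
    using odometer_setD assms by metis
  moreover obtain h where "h \<in> carrier G" "\<And>m. m \<le> n \<Longrightarrow> y m = \<Gamma> m #> h"
    using odometer_setD assms by metis
  ultimately show ?thesis using assms coset_eq_mono[of m n g h] by auto
qed

lemma emb_mem: "g \<in> carrier G \<Longrightarrow> emb g \<in> odometer_set G \<Gamma>"
  by (auto simp: odometer_set_def odometer_emb_def carrier_FactGroup)

text \<open>Density of the image of \<open>G\<close> in the odometer.\<close>

lemma emb_approx:
  assumes "x \<in> odometer_set G \<Gamma>"
  obtains g where "g \<in> carrier G" "emb g n = x n"
  using odometer_setD[OF assms, of n] by (metis odometer_emb_def order_refl)

lemma carrier_odometer [simp]: "carrier D = odometer_set G \<Gamma>"
  by (simp add: odometer_def)

lemma odometer_mult: "(x \<otimes>\<^bsub>D\<^esub> y) n = x n \<otimes>\<^bsub>G Mod \<Gamma> n\<^esub> y n"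
  by (simp add: odometer_def)

lemma subgroup_odometer: "subgroup (odometer_set G \<Gamma>) (product_group UNIV (\<lambda>n. G Mod \<Gamma> n))"
proof (rule subgroup.intro)
  fix x y assume x: "x \<in> odometer_set G \<Gamma>" and y: "y \<in> odometer_set G \<Gamma>"
  show "x \<otimes>\<^bsub>product_group UNIV (\<lambda>n. G Mod \<Gamma> n)\<^esub> y \<in> odometer_set G \<Gamma>"
    unfolding odometer_set_def
  proof (intro CollectI conjI allI)
    show "x \<otimes>\<^bsub>product_group UNIV (\<lambda>n. G Mod \<Gamma> n)\<^esub> y \<in> carrier (product_group UNIV (\<lambda>n. G Mod \<Gamma> n))"
      using x y group_level by (intro group.is_monoid[THEN monoid.m_closed]) (auto simp: odometer_set_def)
    fix n
    obtain g where g: "g \<in> carrier G" "x (Suc n) = \<Gamma> (Suc n) #> g" "x n = \<Gamma> n #> g"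
      using odometer_set_compatible[OF x] .
    obtain h where h: "h \<in> carrier G" "y (Suc n) = \<Gamma> (Suc n) #> h" "y n = \<Gamma> n #> h"
      using odometer_set_compatible[OF y] .
    show "\<exists>g\<in>carrier G. (x \<otimes>\<^bsub>product_group UNIV (\<lambda>n. G Mod \<Gamma> n)\<^esub> y) (Suc n) = \<Gamma> (Suc n) #> g \<and>
        (x \<otimes>\<^bsub>product_group UNIV (\<lambda>n. G Mod \<Gamma> n)\<^esub> y) n = \<Gamma> n #> g"
      using g h normal.rcos_sum[OF normal_level] by (intro bexI[of _ "g \<otimes> h"]) auto
  qed
next
  \<comment> \<open>The unit of the product has coordinates \<open>\<Gamma> n\<close>, so it is the
    embedding of the unit of \<open>G\<close>.\<close>
  show "\<one>\<^bsub>product_group UNIV (\<lambda>n. G Mod \<Gamma> n)\<^esub> \<in> odometer_set G \<Gamma>"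
    using emb_mem[OF one_closed] subgroup_level
    by (simp add: odometer_emb_def coset_mult_one subgroup.subset restrict_UNIV)
next
  fix x assume x: "x \<in> odometer_set G \<Gamma>"
  then have inv: "inv\<^bsub>product_group UNIV (\<lambda>n. G Mod \<Gamma> n)\<^esub> x = (\<lambda>n. set_inv (x n))"
    using group_level normal.inv_FactGroup[OF normal_level level_mem[OF x]]
    by (subst inv_product_group) (auto simp: odometer_set_def restrict_UNIV)
  show "inv\<^bsub>product_group UNIV (\<lambda>n. G Mod \<Gamma> n)\<^esub> x \<in> odometer_set G \<Gamma>"
    unfolding odometer_set_def
  proof (intro CollectI conjI allI)
    show "inv\<^bsub>product_group UNIV (\<lambda>n. G Mod \<Gamma> n)\<^esub> x \<in> carrier (product_group UNIV (\<lambda>n. G Mod \<Gamma> n))"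
      using x group_level by (intro group.inv_closed) (auto simp: odometer_set_def)
    fix n
    obtain g where g: "g \<in> carrier G" "x (Suc n) = \<Gamma> (Suc n) #> g" "x n = \<Gamma> n #> g"
      using odometer_set_compatible[OF x] .
    show "\<exists>g\<in>carrier G. (inv\<^bsub>product_group UNIV (\<lambda>n. G Mod \<Gamma> n)\<^esub> x) (Suc n) = \<Gamma> (Suc n) #> g \<and>
        (inv\<^bsub>product_group UNIV (\<lambda>n. G Mod \<Gamma> n)\<^esub> x) n = \<Gamma> n #> g"
      unfolding inv using g normal.rcos_inv[OF normal_level] by (intro bexI[of _ "inv g"]) auto
  qed
qed (auto simp: odometer_set_def)

sublocale D: group D
  unfolding odometer_def
  using subgroup_odometer group_level by (intro subgroup.subgroup_is_group) auto

lemma odometer_inv: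
  assumes "x \<in> odometer_set G \<Gamma>"
  shows "(inv\<^bsub>D\<^esub> x) n = inv\<^bsub>G Mod \<Gamma> n\<^esub> x n"
proof -
  interpret P: group "product_group UNIV (\<lambda>n. G Mod \<Gamma> n)" using group_level by auto
  have "inv\<^bsub>D\<^esub> x = inv\<^bsub>product_group UNIV (\<lambda>n. G Mod \<Gamma> n)\<^esub> x"
    unfolding odometer_def using P.m_inv_consistent[OF subgroup_odometer assms] .
  then show ?thesis
    using assms group_level by (subst (asm) inv_product_group) (auto simp: odometer_set_def)
qed

lemma mult_mem [simp]: "x \<in> odometer_set G \<Gamma> \<Longrightarrow> y \<in> odometer_set G \<Gamma> \<Longrightarrow> x \<otimes>\<^bsub>D\<^esub> y \<in> odometer_set G \<Gamma>"
  using D.m_closed by simp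

lemma inv_mem [simp]: "x \<in> odometer_set G \<Gamma> \<Longrightarrow> inv\<^bsub>D\<^esub> x \<in> odometer_set G \<Gamma>"
  using D.inv_closed by simp

lemma mult_inv_cancel [simp]:
  assumes "x \<in> odometer_set G \<Gamma>" "y \<in> odometer_set G \<Gamma>"
  shows "x \<otimes>\<^bsub>D\<^esub> inv\<^bsub>D\<^esub> y \<otimes>\<^bsub>D\<^esub> y = x" "x \<otimes>\<^bsub>D\<^esub> y \<otimes>\<^bsub>D\<^esub> inv\<^bsub>D\<^esub> y = x"
  using assms by (simp_all add: D.m_assoc)

lemma emb_level_one: "h \<in> \<Gamma> n \<Longrightarrow> emb h n = \<Gamma> n"
  using coset_join2[OF _ subgroup_level] subgroup.mem_carrier[OF subgroup_level]
  by (simp add: odometer_emb_def)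

lemma mult_level_cong:
  assumes "x n = y n" "z n = w n"
  shows "(x \<otimes>\<^bsub>D\<^esub> z) n = (y \<otimes>\<^bsub>D\<^esub> w) n"
  using assms by (simp add: odometer_mult)

lemma mult_level_one_left:
  assumes "x \<in> odometer_set G \<Gamma>" "y n = \<Gamma> n"
  shows "(y \<otimes>\<^bsub>D\<^esub> x) n = x n"
  using group.is_monoid[OF group_level, THEN monoid.l_one, OF level_mem[OF assms(1), of n]] assms(2)
  by (simp add: odometer_mult)

lemma inv_level_cong:
  assumes "x \<in> odometer_set G \<Gamma>" "y \<in> odometer_set G \<Gamma>" "x n = y n"
  shows "(inv\<^bsub>D\<^esub> x) n = (inv\<^bsub>D\<^esub> y) n"
  using assms by (simp add: odometer_inv)

lemma topspace_X [simp]: "topspace X = odometer_set G \<Gamma>"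
  by (rule topspace_odometer_topology)

section \<open>Topology of the odometer\<close>

lemma continuous_level: "continuous_map X (discrete_topology (carrier (G Mod \<Gamma> n))) (\<lambda>x. x n)"
  unfolding odometer_topology_def
  by (intro continuous_map_from_subtopology continuous_map_product_projection) simp

lemma openin_cylinder: "a \<in> carrier (G Mod \<Gamma> n) \<Longrightarrow> openin X (cylinder G \<Gamma> n a)"
  and closedin_cylinder: "a \<in> carrier (G Mod \<Gamma> n) \<Longrightarrow> closedin X (cylinder G \<Gamma> n a)"
  using openin_continuous_map_preimage[OF continuous_level[of n], of "{a}"]
    closedin_continuous_map_preimage[OF continuous_level[of n], of "{a}"]
  by (simp_all add: cylinder_def)

text \<open>The cylinders around a point form a neighbourhood base. A basic open set of the product
  constrains finitely many coordinates, and by \<open>odometer_prefix\<close> the highest of them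
  controls the others.\<close>

lemma openin_odometer_iff:
  "openin X U \<longleftrightarrow> U \<subseteq> odometer_set G \<Gamma> \<and> (\<forall>x\<in>U. \<exists>n. \<forall>y\<in>odometer_set G \<Gamma>. y n = x n \<longrightarrow> y \<in> U)"
proof (intro iffI conjI ballI)
  assume U: "openin X U"
  then show "U \<subseteq> odometer_set G \<Gamma>" using openin_subset by fastforce
  fix x assume "x \<in> U"
  obtain T where T: "openin (product_topology (\<lambda>n. discrete_topology (carrier (G Mod \<Gamma> n))) UNIV) T"
      "U = T \<inter> odometer_set G \<Gamma>"
    using U by (auto simp: odometer_topology_def openin_subtopology)
  obtain W where W: "finite {i. W i \<noteq> carrier (G Mod \<Gamma> i)}" "x \<in> Pi\<^sub>E UNIV W" "Pi\<^sub>E UNIV W \<subseteq> T"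
    using T \<open>x \<in> U\<close> by (auto simp: openin_product_topology_alt)
  \<comment> \<open>Inserting \<open>0\<close> keeps the set nonempty when no coordinate is
    constrained.\<close>
  define n where "n = Max (insert 0 {i. W i \<noteq> carrier (G Mod \<Gamma> i)})"
  have "y \<in> U" if y: "y \<in> odometer_set G \<Gamma>" "y n = x n" for y
  proof -
    have "y i \<in> W i" for i
    proof (cases "W i = carrier (G Mod \<Gamma> i)")
      case True
      then show ?thesis using y level_mem by blast
    next
      case False
      then have "i \<le> n" using W unfolding n_def by (intro Max_ge) auto
      then have "y i = x i" using odometer_prefix[of y x n i] y \<open>x \<in> U\<close> T by auto
      then show ?thesis using W by auto
    qed
    then show ?thesis using W T y by auto
  qed
  then show "\<exists>n. \<forall>y\<in>odometer_set G \<Gamma>. y n = x n \<longrightarrow> y \<in> U" by blast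
next
  assume *: "U \<subseteq> odometer_set G \<Gamma> \<and> (\<forall>x\<in>U. \<exists>n. \<forall>y\<in>odometer_set G \<Gamma>. y n = x n \<longrightarrow> y \<in> U)"
  have "\<exists>T. openin X T \<and> x \<in> T \<and> T \<subseteq> U" if "x \<in> U" for x
  proof -
    obtain n where "\<forall>y\<in>odometer_set G \<Gamma>. y n = x n \<longrightarrow> y \<in> U" using * \<open>x \<in> U\<close> by blast
    then show ?thesis
      using * \<open>x \<in> U\<close> by (intro exI[of _ "cylinder G \<Gamma> n (x n)"] conjI openin_cylinder level_mem)
        (auto simp: cylinder_def)
  qed
  then show "openin X U" using openin_subopen by metis
qed

text \<open>An epsilon-delta criterion: \<open>m\<close> is the precision demanded of the values,
  \<open>n\<close> the precision required of the arguments.\<close>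

lemma continuous_odometer_iff:
  "continuous_map X X f \<longleftrightarrow> f \<in> odometer_set G \<Gamma> \<rightarrow> odometer_set G \<Gamma> \<and>
     (\<forall>x\<in>odometer_set G \<Gamma>. \<forall>m. \<exists>n. \<forall>y\<in>odometer_set G \<Gamma>. y n = x n \<longrightarrow> f y m = f x m)"
proof (intro iffI conjI ballI allI)
  assume f: "continuous_map X X f"
  then show S: "f \<in> odometer_set G \<Gamma> \<rightarrow> odometer_set G \<Gamma>"
    by (auto simp: continuous_map_def)
  fix x m assume x: "x \<in> odometer_set G \<Gamma>"
  then have "f x \<in> odometer_set G \<Gamma>" using S by auto
  then have "openin X {y \<in> topspace X. f y \<in> cylinder G \<Gamma> m (f x m)}"
    by (intro openin_continuous_map_preimage[OF f] openin_cylinder level_mem)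
  moreover have "x \<in> {y \<in> topspace X. f y \<in> cylinder G \<Gamma> m (f x m)}"
    using \<open>f x \<in> _\<close> x by (simp add: cylinder_def)
  ultimately obtain n where n: "\<And>y. y \<in> odometer_set G \<Gamma> \<Longrightarrow> y n = x n \<Longrightarrow>
      y \<in> {y \<in> topspace X. f y \<in> cylinder G \<Gamma> m (f x m)}"
    unfolding openin_odometer_iff by meson
  show "\<exists>n. \<forall>y\<in>odometer_set G \<Gamma>. y n = x n \<longrightarrow> f y m = f x m"
  proof (intro exI ballI impI)
    fix y assume "y \<in> odometer_set G \<Gamma>" "y n = x n"
    then show "f y m = f x m" using n[of y] by (simp add: cylinder_def)
  qed
next
  assume *: "f \<in> odometer_set G \<Gamma> \<rightarrow> odometer_set G \<Gamma> \<and>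
     (\<forall>x\<in>odometer_set G \<Gamma>. \<forall>m. \<exists>n. \<forall>y\<in>odometer_set G \<Gamma>. y n = x n \<longrightarrow> f y m = f x m)"
  have f: "f \<in> odometer_set G \<Gamma> \<rightarrow> odometer_set G \<Gamma>" using * by (rule conjunct1)
  have "openin X {x \<in> topspace X. f x \<in> U}" if U: "openin X U" for U
    unfolding openin_odometer_iff
  proof (intro conjI ballI)
    fix x assume "x \<in> {x \<in> topspace X. f x \<in> U}"
    then have x: "x \<in> odometer_set G \<Gamma>" "f x \<in> U" by simp_all
    then obtain m where m: "\<And>y. y \<in> odometer_set G \<Gamma> \<Longrightarrow> y m = f x m \<Longrightarrow> y \<in> U"
      using U unfolding openin_odometer_iff by blast
    obtain n where n: "\<forall>y\<in>odometer_set G \<Gamma>. y n = x n \<longrightarrow> f y m = f x m"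
      using spec[OF bspec[OF conjunct2[OF *] x(1)], of m] by (rule exE)
    show "\<exists>n. \<forall>y\<in>odometer_set G \<Gamma>. y n = x n \<longrightarrow> y \<in> {x \<in> topspace X. f x \<in> U}"
    proof (intro exI ballI impI)
      fix y assume y: "y \<in> odometer_set G \<Gamma>" "y n = x n"
      have "f y \<in> odometer_set G \<Gamma>" using y(1) by (rule funcset_mem[OF f])
      then show "y \<in> {x \<in> topspace X. f x \<in> U}" using m n y by simp
    qed
  qed auto
  then show "continuous_map X X f" using f by (simp add: continuous_map_def)
qed

text \<open>The ambient product of finite discrete spaces is compact. Each compatibility condition
  involves two coordinates only, so it is the preimage of a set in a discrete space and hence
  closed.\<close>

lemma compact_odometer: "compact_space X"
proof -
  let ?P = "product_topology (\<lambda>n. discrete_topology (carrier (G Mod \<Gamma> n))) (UNIV :: nat set)"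
  have "compact_space ?P"
    by (simp add: compact_space_product_topology compact_space_discrete_topology finite_level)
  moreover have "closedin ?P (odometer_set G \<Gamma>)"
  proof -
    define C where "C n = {x \<in> topspace ?P. (x (Suc n), x n) \<in> {(\<Gamma> (Suc n) #> g, \<Gamma> n #> g) | g. g \<in> carrier G}}" for n
    have "closedin ?P (C n)" for n
      unfolding C_def
    proof (rule closedin_continuous_map_preimage)
      show "continuous_map ?P (prod_topology (discrete_topology (carrier (G Mod \<Gamma> (Suc n))))
          (discrete_topology (carrier (G Mod \<Gamma> n)))) (\<lambda>x. (x (Suc n), x n))"
        by (intro continuous_map_pairedI continuous_map_product_projection) auto
    qed (auto simp: prod_topology_discrete_topology[symmetric] carrier_FactGroup)
    then have "closedin ?P (\<Inter>n. C n)" by (intro closedin_Inter) auto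
    also have "(\<Inter>n. C n) = odometer_set G \<Gamma>"
      unfolding C_def odometer_set_def carrier_product_group topspace_product_topology
        topspace_discrete_topology by blast
    finally show ?thesis .
  qed
  ultimately show ?thesis
    unfolding odometer_topology_def by (intro compact_space_subtopology closedin_compact_space)
qed

lemma Hausdorff_odometer: "Hausdorff_space X"
  unfolding odometer_topology_def
  by (intro Hausdorff_space_subtopology)
    (simp only: Hausdorff_space_product_topology Hausdorff_space_discrete_topology simp_thms ball_simps)

text \<open>A continuous bijection from a compact space onto a Hausdorff space is a homeomorphism,
  so continuity of inverses need not be checked below.\<close>

lemma Homeo_iff:
  "f \<in> Homeo X \<longleftrightarrow> f \<in> extensional (odometer_set G \<Gamma>) \<and> continuous_map X X f \<and>
     bij_betw f (odometer_set G \<Gamma>) (odometer_set G \<Gamma>)"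
proof -
  have "homeomorphic_map X X f \<longleftrightarrow> continuous_map X X f \<and> bij_betw f (odometer_set G \<Gamma>) (odometer_set G \<Gamma>)"
    using continuous_imp_homeomorphic_map[OF _ compact_odometer Hausdorff_odometer, of f]
    by (auto simp: bij_betw_def homeomorphic_eq_everything_map)
  then show ?thesis by (simp add: Homeo_def)
qed

lemma Homeo_maps: "f \<in> Homeo X \<Longrightarrow> x \<in> odometer_set G \<Gamma> \<Longrightarrow> f x \<in> odometer_set G \<Gamma>"
  by (auto simp: Homeo_iff bij_betw_def)

section \<open>Maps commuting with left translations\<close>

lemma Aut_left_action_iff:
  "f \<in> Aut X (G\<lparr>carrier := H\<rparr>) (left_action G \<Gamma>) \<longleftrightarrow>
     f \<in> Homeo X \<and> (\<forall>h\<in>H. \<forall>x\<in>odometer_set G \<Gamma>. f (emb h \<otimes>\<^bsub>D\<^esub> x) = emb h \<otimes>\<^bsub>D\<^esub> f x)"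
  by (auto simp: Aut_def left_action_def Homeo_maps)

text \<open>The second assumption on \<open>y\<close> says that \<open>y\<close> lies in the closure
  of the image of \<open>H\<close>. Both sides of the equation depend continuously on
  \<open>y\<close>.\<close>

lemma commute_closure:
  assumes f: "f \<in> Aut X (G\<lparr>carrier := H\<rparr>) (left_action G \<Gamma>)" and H: "H \<subseteq> carrier G"
    and y: "y \<in> odometer_set G \<Gamma>" "\<And>n. \<exists>h\<in>H. emb h n = y n"
    and x: "x \<in> odometer_set G \<Gamma>"
  shows "f (y \<otimes>\<^bsub>D\<^esub> x) = y \<otimes>\<^bsub>D\<^esub> f x"
proof
  fix m
  have fH: "f \<in> Homeo X" using f by (simp add: Aut_left_action_iff)
  have yx: "y \<otimes>\<^bsub>D\<^esub> x \<in> odometer_set G \<Gamma>" using y x by (simp add: mult_mem)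
  obtain n where n: "\<And>z. z \<in> odometer_set G \<Gamma> \<Longrightarrow> z n = (y \<otimes>\<^bsub>D\<^esub> x) n \<Longrightarrow> f z m = f (y \<otimes>\<^bsub>D\<^esub> x) m"
    using fH yx unfolding Homeo_iff continuous_odometer_iff by meson
  \<comment> \<open>Agreement at level \<open>n\<close> lets \<open>emb h\<close> replace
    \<open>y\<close> inside \<open>f\<close>; agreement at level \<open>m\<close> lets
    \<open>y\<close> return outside \<open>f\<close>.\<close>
  obtain h where h: "h \<in> H" "emb h (max m n) = y (max m n)" using y(2) by blast
  have eh: "emb h \<in> odometer_set G \<Gamma>" using h H by (auto intro: emb_mem)
  have m: "emb h m = y m" and n': "emb h n = y n"
    using odometer_prefix[OF eh y(1) h(2)] by auto
  have "f (y \<otimes>\<^bsub>D\<^esub> x) m = f (emb h \<otimes>\<^bsub>D\<^esub> x) m"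
    using n[of "emb h \<otimes>\<^bsub>D\<^esub> x"] mult_level_cong[of "emb h" n y x x, OF n' refl] mult_mem[OF eh x] by simp
  also have "f (emb h \<otimes>\<^bsub>D\<^esub> x) = emb h \<otimes>\<^bsub>D\<^esub> f x"
    using f h x by (simp add: Aut_left_action_iff)
  also have "(emb h \<otimes>\<^bsub>D\<^esub> f x) m = (y \<otimes>\<^bsub>D\<^esub> f x) m"
    using m by (intro mult_level_cong) auto
  finally show "f (y \<otimes>\<^bsub>D\<^esub> x) m = (y \<otimes>\<^bsub>D\<^esub> f x) m" .
qed

text \<open>For varying \<open>m\<close> this puts the identity cylinder of level \<open>n\<close>
  in the closure of the image of \<open>\<Gamma> n\<close>: an element of \<open>G\<close> that
  approximates \<open>y\<close> at least up to level \<open>n\<close> automatically lies in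
  \<open>\<Gamma> n\<close>.\<close>

lemma level_kernel_approx:
  assumes y: "y \<in> odometer_set G \<Gamma>" "y n = \<Gamma> n"
  shows "\<exists>h\<in>\<Gamma> n. emb h m = y m"
proof -
  obtain h where h: "h \<in> carrier G" "emb h (max m n) = y (max m n)"
    using emb_approx[OF y(1)] .
  have "emb h m = y m" "emb h n = y n"
    using odometer_prefix[OF emb_mem[OF h(1)] y(1) h(2)] by auto
  moreover have "h \<in> \<Gamma> n"
    using coset_join1[OF _ h(1) subgroup_level] \<open>emb h n = y n\<close> y(2)
    by (simp add: odometer_emb_def)
  ultimately show ?thesis by blast
qed

text \<open>Forwards, a point \<open>p\<close> of a cylinder determines \<open>f\<close> there:
  every other point is \<open>y p\<close> with \<open>y\<close> in the closure of the image of
  \<open>\<Gamma> n\<close>, so \<open>f\<close> sends it to \<open>y (f p)\<close>. Backwards, left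
  multiplication by \<open>\<Gamma> n\<close> preserves every cylinder of level \<open>n\<close> and
  commutes with right translations.\<close>

lemma Aut_level_iff:
  "f \<in> Aut X (G\<lparr>carrier := \<Gamma> n\<rparr>) (left_action G \<Gamma>) \<longleftrightarrow>
     f \<in> Homeo X \<and> (\<forall>a\<in>carrier (G Mod \<Gamma> n). \<exists>\<xi>\<in>odometer_set G \<Gamma>. \<forall>x\<in>cylinder G \<Gamma> n a. f x = x \<otimes>\<^bsub>D\<^esub> inv\<^bsub>D\<^esub> \<xi>)"
  (is "?L \<longleftrightarrow> ?R")
proof
  assume f: ?L
  then have fH: "f \<in> Homeo X" by (simp add: Aut_left_action_iff)
  have "\<exists>\<xi>\<in>odometer_set G \<Gamma>. \<forall>x\<in>cylinder G \<Gamma> n a. f x = x \<otimes>\<^bsub>D\<^esub> inv\<^bsub>D\<^esub> \<xi>" if a: "a \<in> carrier (G Mod \<Gamma> n)" for a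
  proof -
    obtain g where g: "g \<in> carrier G" "a = \<Gamma> n #> g" using a by (auto simp: carrier_FactGroup)
    define p where "p = emb g"
    have p: "p \<in> odometer_set G \<Gamma>" "p n = a"
      using g by (simp_all add: p_def emb_mem) (simp add: odometer_emb_def)
    have fp: "f p \<in> odometer_set G \<Gamma>" using fH p by (simp add: Homeo_maps)
    define \<xi> where "\<xi> = inv\<^bsub>D\<^esub> f p \<otimes>\<^bsub>D\<^esub> p"
    have "f x = x \<otimes>\<^bsub>D\<^esub> inv\<^bsub>D\<^esub> \<xi>" if "x \<in> cylinder G \<Gamma> n a" for x
    proof -
      have x: "x \<in> odometer_set G \<Gamma>" "x n = a" using that by (auto simp: cylinder_def)
      define y where "y = x \<otimes>\<^bsub>D\<^esub> inv\<^bsub>D\<^esub> p"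
      have y: "y \<in> odometer_set G \<Gamma>" using x p by (simp add: y_def mult_mem inv_mem)
      have "y n = \<Gamma> n"
        using group.r_inv[OF group_level a] x p by (simp add: y_def odometer_mult odometer_inv)
      then have "f (y \<otimes>\<^bsub>D\<^esub> p) = y \<otimes>\<^bsub>D\<^esub> f p"
        using level_kernel_approx y p subgroup.subset[OF subgroup_level] by (intro commute_closure[OF f]) auto
      moreover have "y \<otimes>\<^bsub>D\<^esub> p = x" using x p by (simp add: y_def)
      moreover have "y \<otimes>\<^bsub>D\<^esub> f p = x \<otimes>\<^bsub>D\<^esub> inv\<^bsub>D\<^esub> \<xi>"
        using x p fp by (simp add: y_def \<xi>_def D.inv_mult_group D.m_assoc)
      ultimately show ?thesis by simp
    qed
    moreover have "\<xi> \<in> odometer_set G \<Gamma>" using p fp by (simp add: \<xi>_def mult_mem inv_mem)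
    ultimately show ?thesis by blast
  qed
  with fH show ?R by blast
next
  assume R: ?R
  have "f (emb h \<otimes>\<^bsub>D\<^esub> x) = emb h \<otimes>\<^bsub>D\<^esub> f x" if h: "h \<in> \<Gamma> n" and x: "x \<in> odometer_set G \<Gamma>" for h x
  proof -
    obtain \<xi> where \<xi>: "\<xi> \<in> odometer_set G \<Gamma>" "\<And>z. z \<in> cylinder G \<Gamma> n (x n) \<Longrightarrow> f z = z \<otimes>\<^bsub>D\<^esub> inv\<^bsub>D\<^esub> \<xi>"
      using R level_mem[OF x, of n] by blast
    have h': "emb h \<in> odometer_set G \<Gamma>"
      using h subgroup.mem_carrier[OF subgroup_level] by (simp add: emb_mem)
    then have "emb h \<otimes>\<^bsub>D\<^esub> x \<in> cylinder G \<Gamma> n (x n)" "x \<in> cylinder G \<Gamma> n (x n)"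
      using x mult_level_one_left[of x "emb h" n, OF x emb_level_one[OF h]] by (simp_all add: cylinder_def mult_mem)
    then show ?thesis using \<xi> h' x by (simp add: D.m_assoc)
  qed
  then show ?L using R by (simp add: Aut_left_action_iff)
qed

section \<open>Cylinder partitions and maps that translate cylinders\<close>

lemma partition_cylinders: "partition_on (odometer_set G \<Gamma>) (cylinder G \<Gamma> n ` carrier (G Mod \<Gamma> n))"
proof (rule partition_onI)
  have "cylinder G \<Gamma> n a \<noteq> {}" if a: "a \<in> carrier (G Mod \<Gamma> n)" for a
  proof -
    obtain g where "g \<in> carrier G" "a = \<Gamma> n #> g" using a by (auto simp: carrier_FactGroup)
    then have "emb g \<in> cylinder G \<Gamma> n a"
      using emb_mem by (auto simp: cylinder_def odometer_emb_def)
    then show ?thesis by blast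
  qed
  then show "{} \<notin> cylinder G \<Gamma> n ` carrier (G Mod \<Gamma> n)" by auto
  show "\<Union>(cylinder G \<Gamma> n ` carrier (G Mod \<Gamma> n)) = odometer_set G \<Gamma>"
    using level_mem by (auto simp: cylinder_def)
qed (auto simp: cylinder_def disjnt_def)

text \<open>\<open>K\<close> and \<open>\<alpha>\<close> are kept general because this serves both
  \<open>G\<close> with \<open>right_action\<close> and the odometer with
  \<open>right_translation\<close>.\<close>

lemma topological_full_group_cylinderI:
  assumes "f \<in> Homeo X"
    and "\<And>a. a \<in> carrier (G Mod \<Gamma> n) \<Longrightarrow> \<exists>k\<in>carrier K. \<forall>x\<in>cylinder G \<Gamma> n a. f x = \<alpha> k x"
  shows "f \<in> topological_full_group X K \<alpha>"
  unfolding topological_full_group_def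
proof (intro CollectI conjI exI[of _ "cylinder G \<Gamma> n ` carrier (G Mod \<Gamma> n)"] ballI)
  fix A assume "A \<in> cylinder G \<Gamma> n ` carrier (G Mod \<Gamma> n)"
  then show "openin X A" "closedin X A" "\<exists>g\<in>carrier K. \<forall>y\<in>A. f y = \<alpha> g y"
    using assms(2) openin_cylinder closedin_cylinder by auto
qed (use assms partition_cylinders finite_level in auto)

text \<open>A Lebesgue number argument: each point has a cylinder inside one piece, finitely many of
  these cylinders cover the space, and the largest of their levels works everywhere.\<close>

lemma open_partition_refined:
  assumes P: "partition_on (odometer_set G \<Gamma>) P" "\<And>A. A \<in> P \<Longrightarrow> openin X A"
  obtains n where "\<And>A x y. A \<in> P \<Longrightarrow> x \<in> A \<Longrightarrow> y \<in> odometer_set G \<Gamma> \<Longrightarrow> y n = x n \<Longrightarrow> y \<in> A"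
proof -
  have U: "\<Union>P = odometer_set G \<Gamma>" using P by (simp add: partition_on_def)
  have "\<exists>n. \<exists>A\<in>P. \<forall>y\<in>odometer_set G \<Gamma>. y n = x n \<longrightarrow> y \<in> A" if x: "x \<in> odometer_set G \<Gamma>" for x
  proof -
    obtain A where A: "A \<in> P" "x \<in> A" using x U by blast
    have "\<forall>x\<in>A. \<exists>n. \<forall>y\<in>odometer_set G \<Gamma>. y n = x n \<longrightarrow> y \<in> A"
      using P(2)[OF A(1)] unfolding openin_odometer_iff by (rule conjunct2)
    then show ?thesis using A by meson
  qed
  then obtain N where N: "\<And>x. x \<in> odometer_set G \<Gamma> \<Longrightarrow> \<exists>A\<in>P. \<forall>y\<in>odometer_set G \<Gamma>. y (N x) = x (N x) \<longrightarrow> y \<in> A"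
    by metis
  define c where "c x = cylinder G \<Gamma> (N x) (x (N x))" for x
  have "\<forall>V\<in>c ` odometer_set G \<Gamma>. openin X V"
    by (auto simp: c_def intro!: openin_cylinder level_mem)
  moreover have "topspace X \<subseteq> \<Union>(c ` odometer_set G \<Gamma>)"
    by (auto simp: c_def cylinder_def)
  ultimately obtain F where F: "finite F" "F \<subseteq> c ` odometer_set G \<Gamma>" "topspace X \<subseteq> \<Union>F"
    using compact_odometer unfolding compact_space_def compactin_def by meson
  obtain Q where Q: "Q \<subseteq> odometer_set G \<Gamma>" "finite Q" "F = c ` Q"
    using finite_subset_image[OF F(1,2)] by blast
  define n where "n = Max (insert 0 (N ` Q))"
  show thesis
  proof (rule that[of n])
    fix A x y assume A: "A \<in> P" "x \<in> A" and y: "y \<in> odometer_set G \<Gamma>" "y n = x n"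
    have x: "x \<in> odometer_set G \<Gamma>" using A U by blast
    then obtain q where q: "q \<in> Q" "x (N q) = q (N q)"
      using F(3) Q by (auto simp: c_def cylinder_def)
    have "N q \<le> n" unfolding n_def using Q q by (intro Max_ge) auto
    then have "y (N q) = q (N q)" using odometer_prefix[OF y(1) x y(2)] q by simp
    \<comment> \<open>Both \<open>x\<close> and \<open>y\<close> lie in the cylinder of
      \<open>q\<close>, hence in one piece \<open>B\<close>; as \<open>A\<close> also contains
      \<open>x\<close>, disjointness identifies the two.\<close>
    moreover obtain B where B: "B \<in> P" "\<forall>y\<in>odometer_set G \<Gamma>. y (N q) = q (N q) \<longrightarrow> y \<in> B"
      using N Q q by blast
    ultimately have "x \<in> B" "y \<in> B" using x y q by auto
    moreover have "A = B"
      using P(1) A B(1) \<open>x \<in> B\<close> by (auto simp: partition_on_def disjoint_def)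
    ultimately show "y \<in> A" by simp
  qed
qed

text \<open>Translating elements that agree at level \<open>n\<close> move the cylinders of level
  \<open>n\<close> in the same way. Bijectivity is therefore inherited from \<open>f\<close>:
  cylinders keep their images, and inside each one the new map is still a translation.\<close>

lemma Homeo_cylinder_perturbation:
  assumes f: "f \<in> Homeo X"
    and \<xi>: "\<And>a. a \<in> carrier (G Mod \<Gamma> n) \<Longrightarrow> \<xi> a \<in> odometer_set G \<Gamma>"
      "\<And>x. x \<in> odometer_set G \<Gamma> \<Longrightarrow> f x = x \<otimes>\<^bsub>D\<^esub> inv\<^bsub>D\<^esub> \<xi> (x n)"
    and \<eta>: "\<And>a. a \<in> carrier (G Mod \<Gamma> n) \<Longrightarrow> \<eta> a \<in> odometer_set G \<Gamma>"
      "\<And>a. a \<in> carrier (G Mod \<Gamma> n) \<Longrightarrow> \<eta> a n = \<xi> a n"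
  shows "(\<lambda>x\<in>odometer_set G \<Gamma>. x \<otimes>\<^bsub>D\<^esub> inv\<^bsub>D\<^esub> \<eta> (x n)) \<in> Homeo X" (is "?F \<in> _")
proof -
  have bij: "bij_betw f (odometer_set G \<Gamma>) (odometer_set G \<Gamma>)" using f by (simp add: Homeo_iff)
  have mem: "\<xi> (x n) \<in> odometer_set G \<Gamma>" "\<eta> (x n) \<in> odometer_set G \<Gamma>" if "x \<in> odometer_set G \<Gamma>" for x
    using that \<xi>(1) \<eta>(1) level_mem by auto
  have level: "?F x n = f x n" if x: "x \<in> odometer_set G \<Gamma>" for x
    using x \<xi>(2)[OF x] inv_level_cong[OF mem(2)[OF x] mem(1)[OF x] \<eta>(2)[OF level_mem[OF x]]]
    by (simp add: odometer_mult)
  \<comment> \<open>A cylinder is carried onto the whole cylinder it meets, so injectivity of \<open>f\<close> passes to levels.\<close>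
  have inj: "x n = y n" if x: "x \<in> odometer_set G \<Gamma>" and y: "y \<in> odometer_set G \<Gamma>" and eq: "f x n = f y n" for x y
  proof -
    \<comment> \<open>The preimage of \<open>f y\<close> under the translation that \<open>f\<close>
      performs on the cylinder of \<open>x\<close>; it lies in that cylinder because
      \<open>f x\<close> and \<open>f y\<close> agree at level \<open>n\<close>.\<close>
    define z where "z = f y \<otimes>\<^bsub>D\<^esub> \<xi> (x n)"
    have z: "z \<in> odometer_set G \<Gamma>" using f x y mem by (simp add: z_def mult_mem Homeo_maps)
    have "z n = (f x \<otimes>\<^bsub>D\<^esub> \<xi> (x n)) n" unfolding z_def using eq by (intro mult_level_cong) auto
    also have "f x \<otimes>\<^bsub>D\<^esub> \<xi> (x n) = x" using \<xi>(2)[OF x] x mem(1)[OF x] by simp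
    finally have "f z = f y" "z n = x n"
      using \<xi>(2)[OF z] mem(1)[OF x] f y by (simp_all add: z_def Homeo_maps)
    then show ?thesis using bij z y by (auto simp: bij_betw_def dest: inj_onD)
  qed
  have "inj_on ?F (odometer_set G \<Gamma>)"
  proof (rule inj_onI)
    fix x y assume x: "x \<in> odometer_set G \<Gamma>" and y: "y \<in> odometer_set G \<Gamma>" and eq: "?F x = ?F y"
    have "x n = y n" using inj[OF x y] level[OF x] level[OF y] eq by simp
    then show "x = y" using eq x y mem(2)[OF x] by (simp add: inv_mem)
  qed
  moreover have "?F ` odometer_set G \<Gamma> = odometer_set G \<Gamma>"
  proof
    show "?F ` odometer_set G \<Gamma> \<subseteq> odometer_set G \<Gamma>" using mem by (auto intro!: mult_mem inv_mem)
    show "odometer_set G \<Gamma> \<subseteq> ?F ` odometer_set G \<Gamma>"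
    proof
      fix y assume y: "y \<in> odometer_set G \<Gamma>"
      then obtain w where w: "w \<in> odometer_set G \<Gamma>" "y = f w" using bij by (auto simp: bij_betw_def)
      \<comment> \<open>The preimage \<open>w\<close> under \<open>f\<close> indicates which
        cylinder must contain the preimage under the new map.\<close>
      define x where "x = y \<otimes>\<^bsub>D\<^esub> \<eta> (w n)"
      have x: "x \<in> odometer_set G \<Gamma>" using y mem[OF w(1)] by (simp add: x_def mult_mem)
      have "x n = (y \<otimes>\<^bsub>D\<^esub> \<xi> (w n)) n"
        unfolding x_def using \<eta>(2)[OF level_mem[OF w(1)]] by (intro mult_level_cong) auto
      also have "y \<otimes>\<^bsub>D\<^esub> \<xi> (w n) = w" using \<xi>(2)[OF w(1)] w mem(1)[OF w(1)] by simp
      finally have "?F x = y" using x y mem(2)[OF w(1)] by (simp add: x_def)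
      then show "y \<in> ?F ` odometer_set G \<Gamma>" using x by blast
    qed
  qed
  moreover have "continuous_map X X ?F"
    unfolding continuous_odometer_iff
  proof (intro conjI ballI allI)
    show "?F \<in> odometer_set G \<Gamma> \<rightarrow> odometer_set G \<Gamma>" using mem by (auto intro!: mult_mem inv_mem)
    fix x m assume x: "x \<in> odometer_set G \<Gamma>"
    have "?F y m = ?F x m" if y: "y \<in> odometer_set G \<Gamma>" and eq: "y (max m n) = x (max m n)" for y
    proof -
      have "y m = x m" "y n = x n" using odometer_prefix[OF y x eq] by auto
      then show ?thesis using x y by (simp add: odometer_mult)
    qed
    then show "\<exists>k. \<forall>y\<in>odometer_set G \<Gamma>. y k = x k \<longrightarrow> ?F y m = ?F x m" by blast
  qed
  ultimately show ?thesis by (simp add: Homeo_iff bij_betw_def)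
qed

section \<open>Uniform closures of the level sets\<close>

text \<open>A disagreement persists at all higher levels, so agreement at level \<open>m\<close>
  means that the first disagreement, if any, occurs at \<open>Suc m\<close> or later. Hence the
  exponent.\<close>

lemma odometer_dist_le_iff:
  assumes x: "x \<in> odometer_set G \<Gamma>" and y: "y \<in> odometer_set G \<Gamma>"
  shows "odometer_dist x y \<le> (1/2) ^ Suc m \<longleftrightarrow> x m = y m"
proof (cases "x = y")
  case False
  define k where "k = (LEAST n. x n \<noteq> y n)"
  have d: "odometer_dist x y = (1/2) ^ k" using False by (simp add: odometer_dist_def k_def)
  have "x k \<noteq> y k" unfolding k_def by (rule LeastI_ex) (use False in auto)
  then have "x m = y m \<Longrightarrow> Suc m \<le> k"
    using odometer_prefix[OF x y, of m k] by (metis not_less_eq_eq)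
  moreover have "x m \<noteq> y m \<Longrightarrow> k \<le> m" unfolding k_def by (rule Least_le)
  ultimately have "x m = y m \<longleftrightarrow> Suc m \<le> k" by fastforce
  then show ?thesis unfolding d by (simp add: power_decreasing_iff del: power_Suc)
qed (simp add: odometer_dist_def)

text \<open>A supremum distance of at most \<open>(1/2) ^ Suc m\<close> means agreement at level
  \<open>m\<close> at every point, and these radii tend to zero.\<close>

lemma in_uniform_closure_iff:
  assumes A: "A \<subseteq> Homeo X"
  shows "f \<in> (uniform_topology X (odometer_metric G \<Gamma>)) closure_of A \<longleftrightarrow>
     f \<in> Homeo X \<and> (\<forall>m. \<exists>g\<in>A. \<forall>x\<in>odometer_set G \<Gamma>. f x m = g x m)"
proof -
  interpret M: Metric_space "odometer_set G \<Gamma>" odometer_dist by (rule Metric_space_odometer)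
  interpret F: Metric_space "M.fspace (odometer_set G \<Gamma>)" "M.fdist (odometer_set G \<Gamma>)"
    by (rule M.Metric_space_funspace)
  have ne: "odometer_set G \<Gamma> \<noteq> {}" using emb_mem[OF one_closed] by blast
  \<comment> \<open>Elements of the function space must have bounded image; here distances never
    exceed 1.\<close>
  have bounded: "M.mbounded S" if "S \<subseteq> odometer_set G \<Gamma>" for S
  proof -
    have "S \<subseteq> M.mcball (emb \<one>) 1"
      using that emb_mem[OF one_closed] by (auto simp: odometer_dist_def power_le_one)
    then show ?thesis unfolding M.mbounded_def by blast
  qed
  have Homeo: "g \<in> M.fspace (odometer_set G \<Gamma>)" if "g \<in> Homeo X" for g
    using that bounded[of "g ` odometer_set G \<Gamma>"] by (auto simp: M.fspace_def Homeo_iff bij_betw_def)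
  have "uniform_topology X (odometer_metric G \<Gamma>) = subtopology F.mtopology (Homeo X)"
    by (simp add: uniform_topology_def mtopology_of_def odometer_metric_def)
  then have "f \<in> (uniform_topology X (odometer_metric G \<Gamma>)) closure_of A \<longleftrightarrow>
      f \<in> Homeo X \<and> f \<in> F.mtopology closure_of A"
    using A by (simp add: closure_of_subtopology Int_absorb1)
  also have "\<dots> \<longleftrightarrow> f \<in> Homeo X \<and> (\<forall>m. \<exists>g\<in>A. \<forall>x\<in>odometer_set G \<Gamma>. f x m = g x m)"
  proof (rule conj_cong[OF refl])
    assume f: "f \<in> Homeo X"
    have le: "M.fdist (odometer_set G \<Gamma>) f g \<le> (1/2) ^ Suc m \<longleftrightarrow> (\<forall>x\<in>odometer_set G \<Gamma>. f x m = g x m)"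
      if "g \<in> A" for g m
      using M.funspace_mdist_le[OF Homeo[OF f] Homeo ne, of g] that A f
      by (auto simp: odometer_dist_le_iff Homeo_maps subset_iff simp del: power_Suc)
    have "f \<in> F.mtopology closure_of A \<longleftrightarrow> (\<forall>r>0. \<exists>g\<in>A. M.fdist (odometer_set G \<Gamma>) f g \<le> r)"
      using A Homeo f unfolding F.metric_closure_of_alt by (auto simp: subset_iff)
    also have "\<dots> \<longleftrightarrow> (\<forall>m. \<exists>g\<in>A. M.fdist (odometer_set G \<Gamma>) f g \<le> (1/2) ^ Suc m)"
    proof (intro iffI allI impI)
      fix r :: real assume "0 < r" and *: "\<forall>m. \<exists>g\<in>A. M.fdist (odometer_set G \<Gamma>) f g \<le> (1/2) ^ Suc m"
      obtain m where "(1/2) ^ m < r" using real_arch_pow_inv[OF \<open>0 < r\<close>, of "1/2"] by auto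
      moreover have "(1/2::real) ^ Suc m \<le> (1/2) ^ m" by simp
      moreover obtain g where "g \<in> A" "M.fdist (odometer_set G \<Gamma>) f g \<le> (1/2) ^ Suc m" using * by blast
      ultimately show "\<exists>g\<in>A. M.fdist (odometer_set G \<Gamma>) f g \<le> r" by (intro bexI[of _ g]) linarith+
    qed (simp del: power_Suc)
    also have "\<dots> \<longleftrightarrow> (\<forall>m. \<exists>g\<in>A. \<forall>x\<in>odometer_set G \<Gamma>. f x m = g x m)" by (simp only: le cong: bex_cong)
    finally show "f \<in> F.mtopology closure_of A \<longleftrightarrow> (\<forall>m. \<exists>g\<in>A. \<forall>x\<in>odometer_set G \<Gamma>. f x m = g x m)" .
  qed
  finally show ?thesis .
qed

lemma right_full_group_level_subset_Homeo: "right_full_group_level G \<Gamma> n \<subseteq> Homeo X"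
  by (auto simp: right_full_group_level_def topological_full_group_def)

lemma right_full_group_level_subset_Aut:
  "right_full_group_level G \<Gamma> n \<subseteq> Aut X (G\<lparr>carrier := \<Gamma> n\<rparr>) (left_action G \<Gamma>)"
proof
  fix f assume f: "f \<in> right_full_group_level G \<Gamma> n"
  have "\<exists>\<xi>\<in>odometer_set G \<Gamma>. \<forall>x\<in>cylinder G \<Gamma> n a. f x = x \<otimes>\<^bsub>D\<^esub> inv\<^bsub>D\<^esub> \<xi>" if a: "a \<in> carrier (G Mod \<Gamma> n)" for a
  proof -
    obtain g where "g \<in> carrier G" "\<forall>x\<in>cylinder G \<Gamma> n a. f x = right_action G \<Gamma> g x"
      using f a by (auto simp: right_full_group_level_def)
    then show ?thesis
      using emb_mem by (intro bexI[of _ "emb g"]) (auto simp: right_action_def cylinder_def)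
  qed
  then show "f \<in> Aut X (G\<lparr>carrier := \<Gamma> n\<rparr>) (left_action G \<Gamma>)"
    using f right_full_group_level_subset_Homeo by (auto simp: Aut_level_iff)
qed

text \<open>Commutation with \<open>emb h\<close> is tested coordinate by coordinate, so it survives
  uniform limits. Conversely, \<open>Aut_level_iff\<close> presents \<open>f\<close> as a
  translation on each cylinder, and density of the image of \<open>G\<close> lets the translating
  elements be approximated.\<close>

lemma closure_right_full_group_level:
  "(uniform_topology X (odometer_metric G \<Gamma>)) closure_of (right_full_group_level G \<Gamma> n) =
     Aut X (G\<lparr>carrier := \<Gamma> n\<rparr>) (left_action G \<Gamma>)"
proof (intro equalityI subsetI)
  fix f assume "f \<in> (uniform_topology X (odometer_metric G \<Gamma>)) closure_of (right_full_group_level G \<Gamma> n)"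
  then have f: "f \<in> Homeo X"
    and approx: "\<And>m. \<exists>g\<in>right_full_group_level G \<Gamma> n. \<forall>x\<in>odometer_set G \<Gamma>. f x m = g x m"
    by (simp_all add: in_uniform_closure_iff right_full_group_level_subset_Homeo)
  have "f (emb h \<otimes>\<^bsub>D\<^esub> x) = emb h \<otimes>\<^bsub>D\<^esub> f x" if h: "h \<in> \<Gamma> n" and x: "x \<in> odometer_set G \<Gamma>" for h x
  proof
    fix m
    obtain g where g: "g \<in> right_full_group_level G \<Gamma> n" "\<And>x. x \<in> odometer_set G \<Gamma> \<Longrightarrow> f x m = g x m"
      using approx by blast
    have "emb h \<otimes>\<^bsub>D\<^esub> x \<in> odometer_set G \<Gamma>"
      using h x subgroup.mem_carrier[OF subgroup_level] by (simp add: emb_mem mult_mem)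
    then have "f (emb h \<otimes>\<^bsub>D\<^esub> x) m = g (emb h \<otimes>\<^bsub>D\<^esub> x) m" by (rule g)
    also have "g (emb h \<otimes>\<^bsub>D\<^esub> x) = emb h \<otimes>\<^bsub>D\<^esub> g x"
      using subsetD[OF right_full_group_level_subset_Aut g(1)] h x by (simp add: Aut_left_action_iff)
    also have "(emb h \<otimes>\<^bsub>D\<^esub> g x) m = (emb h \<otimes>\<^bsub>D\<^esub> f x) m"
      using g(2)[OF x] by (intro mult_level_cong) auto
    finally show "f (emb h \<otimes>\<^bsub>D\<^esub> x) m = (emb h \<otimes>\<^bsub>D\<^esub> f x) m" .
  qed
  then show "f \<in> Aut X (G\<lparr>carrier := \<Gamma> n\<rparr>) (left_action G \<Gamma>)"
    using f by (simp add: Aut_left_action_iff)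
next
  fix f assume "f \<in> Aut X (G\<lparr>carrier := \<Gamma> n\<rparr>) (left_action G \<Gamma>)"
  then have f: "f \<in> Homeo X"
    and "\<forall>a\<in>carrier (G Mod \<Gamma> n). \<exists>\<xi>. \<xi> \<in> odometer_set G \<Gamma> \<and> (\<forall>x\<in>cylinder G \<Gamma> n a. f x = x \<otimes>\<^bsub>D\<^esub> inv\<^bsub>D\<^esub> \<xi>)"
    unfolding Aut_level_iff by blast+
  then obtain \<xi> where \<xi>: "\<And>a. a \<in> carrier (G Mod \<Gamma> n) \<Longrightarrow> \<xi> a \<in> odometer_set G \<Gamma>"
      "\<And>a x. a \<in> carrier (G Mod \<Gamma> n) \<Longrightarrow> x \<in> cylinder G \<Gamma> n a \<Longrightarrow> f x = x \<otimes>\<^bsub>D\<^esub> inv\<^bsub>D\<^esub> \<xi> a"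
    by metis
  have \<xi>': "f x = x \<otimes>\<^bsub>D\<^esub> inv\<^bsub>D\<^esub> \<xi> (x n)" if "x \<in> odometer_set G \<Gamma>" for x
    using that \<xi>(2)[OF level_mem] by (simp add: cylinder_def)
  have "\<exists>g\<in>right_full_group_level G \<Gamma> n. \<forall>x\<in>odometer_set G \<Gamma>. f x m = g x m" for m
  proof -
    \<comment> \<open>Agreement at level \<open>n\<close> makes the perturbed map a homeomorphism;
      agreement at level \<open>m\<close> makes it close to \<open>f\<close>.\<close>
    have "\<exists>g\<in>carrier G. emb g (max m n) = \<xi> a (max m n)" if "a \<in> carrier (G Mod \<Gamma> n)" for a
      using emb_approx[OF \<xi>(1)[OF that]] by blast
    then obtain k where k: "\<And>a. a \<in> carrier (G Mod \<Gamma> n) \<Longrightarrow> k a \<in> carrier G"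
        "\<And>a. a \<in> carrier (G Mod \<Gamma> n) \<Longrightarrow> emb (k a) (max m n) = \<xi> a (max m n)"
      by metis
    have eq: "emb (k a) m = \<xi> a m" "emb (k a) n = \<xi> a n" if a: "a \<in> carrier (G Mod \<Gamma> n)" for a
      using odometer_prefix[OF emb_mem[OF k(1)[OF a]] \<xi>(1)[OF a] k(2)[OF a]] by auto
    define g where "g = (\<lambda>x\<in>odometer_set G \<Gamma>. x \<otimes>\<^bsub>D\<^esub> inv\<^bsub>D\<^esub> emb (k (x n)))"
    have gH: "g \<in> Homeo X"
      unfolding g_def using k(1) eq \<xi>(1) \<xi>' emb_mem
      by (intro Homeo_cylinder_perturbation[OF f, where \<xi> = \<xi> and \<eta> = "\<lambda>a. emb (k a)"]) auto
    have act: "\<exists>h\<in>carrier G. \<forall>x\<in>cylinder G \<Gamma> n a. g x = right_action G \<Gamma> h x"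
      if "a \<in> carrier (G Mod \<Gamma> n)" for a
      using k(1)[OF that] by (intro bexI[of _ "k a"]) (auto simp: g_def right_action_def cylinder_def)
    have "g \<in> right_full_group_level G \<Gamma> n"
      using topological_full_group_cylinderI[OF gH act] act by (simp add: right_full_group_level_def)
    moreover have "f x m = g x m" if x: "x \<in> odometer_set G \<Gamma>" for x
      using x \<xi>'[OF x] eq(1)[OF level_mem[OF x]]
        inv_level_cong[OF emb_mem[OF k(1)[OF level_mem[OF x]]] \<xi>(1)[OF level_mem[OF x]]]
      by (simp add: g_def odometer_mult)
    ultimately show ?thesis by blast
  qed
  then show "f \<in> (uniform_topology X (odometer_metric G \<Gamma>)) closure_of (right_full_group_level G \<Gamma> n)"
    using f by (simp add: in_uniform_closure_iff right_full_group_level_subset_Homeo)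
qed

section \<open>The full group of right translations\<close>

text \<open>The cylinders of one level form an admissible partition, and by
  \<open>open_partition_refined\<close> every admissible partition is refined by the cylinders of
  some level. \<open>Aut_level_iff\<close> does the rest.\<close>

lemma Union_Aut_level_eq_full_group:
  "(\<Union>n. Aut X (G\<lparr>carrier := \<Gamma> n\<rparr>) (left_action G \<Gamma>)) =
     topological_full_group X D (right_translation G \<Gamma>)"
proof (intro equalityI subsetI)
  fix f assume "f \<in> (\<Union>n. Aut X (G\<lparr>carrier := \<Gamma> n\<rparr>) (left_action G \<Gamma>))"
  then obtain n where n: "f \<in> Aut X (G\<lparr>carrier := \<Gamma> n\<rparr>) (left_action G \<Gamma>)" by blast
  show "f \<in> topological_full_group X D (right_translation G \<Gamma>)"
  proof (rule topological_full_group_cylinderI)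
    show "f \<in> Homeo X" using n by (simp add: Aut_level_iff)
    show "\<exists>\<xi>\<in>carrier D. \<forall>x\<in>cylinder G \<Gamma> n a. f x = right_translation G \<Gamma> \<xi> x"
      if a: "a \<in> carrier (G Mod \<Gamma> n)" for a
    proof -
      obtain \<xi> where "\<xi> \<in> odometer_set G \<Gamma>" "\<forall>x\<in>cylinder G \<Gamma> n a. f x = x \<otimes>\<^bsub>D\<^esub> inv\<^bsub>D\<^esub> \<xi>"
        using n a unfolding Aut_level_iff by blast
      then show ?thesis by (intro bexI[of _ \<xi>]) (auto simp: right_translation_def cylinder_def)
    qed
  qed
next
  fix f assume "f \<in> topological_full_group X D (right_translation G \<Gamma>)"
  then obtain P where f: "f \<in> Homeo X" and P: "partition_on (odometer_set G \<Gamma>) P"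
      "\<And>A. A \<in> P \<Longrightarrow> openin X A"
      "\<And>A. A \<in> P \<Longrightarrow> \<exists>\<xi>\<in>odometer_set G \<Gamma>. \<forall>y\<in>A. f y = right_translation G \<Gamma> \<xi> y"
    unfolding topological_full_group_def topspace_X carrier_odometer by blast
  obtain n where n: "\<And>A x y. A \<in> P \<Longrightarrow> x \<in> A \<Longrightarrow> y \<in> odometer_set G \<Gamma> \<Longrightarrow> y n = x n \<Longrightarrow> y \<in> A"
    using open_partition_refined[OF P(1,2)] by blast
  have "\<exists>\<xi>\<in>odometer_set G \<Gamma>. \<forall>x\<in>cylinder G \<Gamma> n a. f x = x \<otimes>\<^bsub>D\<^esub> inv\<^bsub>D\<^esub> \<xi>" if a: "a \<in> carrier (G Mod \<Gamma> n)" for a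
  proof -
    obtain g where g: "g \<in> carrier G" "a = \<Gamma> n #> g" using a by (auto simp: carrier_FactGroup)
    \<comment> \<open>The point \<open>emb g\<close> of the cylinder selects a piece; the choice of
      \<open>n\<close> puts the whole cylinder in it.\<close>
    obtain A where A: "A \<in> P" "emb g \<in> A"
      using P(1) emb_mem[OF g(1)] by (auto simp: partition_on_def)
    obtain \<xi> where \<xi>: "\<xi> \<in> odometer_set G \<Gamma>" "\<forall>y\<in>A. f y = right_translation G \<Gamma> \<xi> y"
      using P(3) A by blast
    have "x \<in> A" if "x \<in> cylinder G \<Gamma> n a" for x
      using that g by (intro n[OF A]) (auto simp: cylinder_def odometer_emb_def)
    then show ?thesis
      using \<xi> by (intro bexI[of _ \<xi>]) (auto simp: right_translation_def cylinder_def)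
  qed
  then have "f \<in> Aut X (G\<lparr>carrier := \<Gamma> n\<rparr>) (left_action G \<Gamma>)"
    using f by (simp add: Aut_level_iff)
  then show "f \<in> (\<Union>n. Aut X (G\<lparr>carrier := \<Gamma> n\<rparr>) (left_action G \<Gamma>))" by blast
qed

section \<open>Finite-index subgroups and the stabilized automorphism group\<close>

lemma finite_index_closure_contains_level:
  assumes "finite_index_subgroup H G"
  obtains N where "\<And>g n. g \<in> \<Gamma> N \<Longrightarrow> \<exists>h\<in>H. emb h n = emb g n"
proof -
  have H: "subgroup H G" "finite (rcosets H)"
    using assms by (simp_all add: finite_index_subgroup_def)
  \<comment> \<open>The sets \<open>H\<Gamma>\<^sub>n\<close> are decreasing unions of finitely many cosets of \<open>H\<close>, hence eventually constant.\<close>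
  define C where "C n = {c \<in> rcosets H. c \<inter> \<Gamma> n \<noteq> {}}" for n
  have fin: "finite (C n)" for n using H(2) by (simp add: C_def)
  \<comment> \<open>\<open>N\<close> minimises the number of cosets met. Since \<open>C n\<close> is
    contained in \<open>C N\<close> for \<open>N \<le> n\<close>, minimality forces
    equality.\<close>
  obtain N where N: "\<And>n. card (C N) \<le> card (C n)"
    using ex_has_least_nat[of "\<lambda>_. True" _ "\<lambda>n. card (C n)"] by auto
  have CN: "C n = C N" if "N \<le> n" for n
    using level_antimono[OF that] by (intro card_seteq fin N) (auto simp: C_def)
  have "\<exists>h\<in>H. emb h n = emb g n" if g: "g \<in> \<Gamma> N" for g n
  proof -
    define k where "k = max n N"
    have gG: "g \<in> carrier G" using g subgroup.mem_carrier[OF subgroup_level] by blast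
    have "H #> g \<in> C N"
      using rcos_self[OF gG H(1)] rcosetsI[OF subgroup.subset[OF H(1)] gG] g by (auto simp: C_def)
    then have "H #> g \<in> C k" using CN[of k] by (simp add: k_def)
    then obtain d where d: "d \<in> \<Gamma> k" "d \<in> H #> g" by (auto simp: C_def)
    then obtain h where h: "h \<in> H" "d = h \<otimes> g" by (auto simp: r_coset_def)
    have hG: "h \<in> carrier G" using h subgroup.mem_carrier[OF H(1)] by blast
    have dG: "d \<in> carrier G" using h gG hG by simp
    \<comment> \<open>As \<open>d\<close> lies in \<open>\<Gamma> k\<close>, this shows that
      \<open>g\<close> and \<open>inv h\<close> have the same coset at level \<open>k\<close>, so
      \<open>inv h\<close> is the required element of \<open>H\<close>.\<close>
    have "g = inv h \<otimes> d" using h gG hG by (simp add: m_assoc[symmetric])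
    then have "emb g k = (\<Gamma> k #> inv h) <#> (\<Gamma> k #> d)"
      using hG dG normal.rcos_sum[OF normal_level] by (simp add: odometer_emb_def)
    also have "\<Gamma> k #> d = \<Gamma> k" using d dG by (simp add: coset_join2 subgroup_level)
    also have "(\<Gamma> k #> inv h) <#> \<Gamma> k = \<Gamma> k #> inv h"
      using group.is_monoid[OF group_level, THEN monoid.r_one, of "\<Gamma> k #> inv h" k] hG
      by (simp add: carrier_FactGroup)
    finally have "emb (inv h) k = emb g k" by (simp add: odometer_emb_def)
    then have "emb (inv h) n = emb g n"
      using odometer_prefix[OF emb_mem emb_mem, of "inv h" g k n] hG gG by (simp add: k_def)
    then show ?thesis using subgroup.m_inv_closed[OF H(1) h(1)] by blast
  qed
  then show thesis by (rule that)
qed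

lemma stabilized_Aut_eq:
  "stabilized_Aut X G (left_action G \<Gamma>) = (\<Union>n. Aut X (G\<lparr>carrier := \<Gamma> n\<rparr>) (left_action G \<Gamma>))"
proof (intro equalityI subsetI)
  fix f assume "f \<in> stabilized_Aut X G (left_action G \<Gamma>)"
  then obtain H where H: "finite_index_subgroup H G" and f: "f \<in> Aut X (G\<lparr>carrier := H\<rparr>) (left_action G \<Gamma>)"
    by (auto simp: stabilized_Aut_def)
  have HG: "H \<subseteq> carrier G" using H by (simp add: finite_index_subgroup_def subgroup.subset)
  obtain N where N: "\<And>g n. g \<in> \<Gamma> N \<Longrightarrow> \<exists>h\<in>H. emb h n = emb g n"
    using finite_index_closure_contains_level[OF H] by blast
  have "f (emb g \<otimes>\<^bsub>D\<^esub> x) = emb g \<otimes>\<^bsub>D\<^esub> f x" if "g \<in> \<Gamma> N" "x \<in> odometer_set G \<Gamma>" for g x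
    using that N subgroup.mem_carrier[OF subgroup_level]
    by (intro commute_closure[OF f HG]) (auto intro: emb_mem)
  then have "f \<in> Aut X (G\<lparr>carrier := \<Gamma> N\<rparr>) (left_action G \<Gamma>)"
    using f by (simp add: Aut_left_action_iff)
  then show "f \<in> (\<Union>n. Aut X (G\<lparr>carrier := \<Gamma> n\<rparr>) (left_action G \<Gamma>))" by blast
next
  fix f assume "f \<in> (\<Union>n. Aut X (G\<lparr>carrier := \<Gamma> n\<rparr>) (left_action G \<Gamma>))"
  moreover have "finite_index_subgroup (\<Gamma> n) G" for n using scale by (simp add: scale_def)
  ultimately show "f \<in> stabilized_Aut X G (left_action G \<Gamma>)" unfolding stabilized_Aut_def by blast
qed

text \<open>Along the scale the union is increasing: a smaller \<open>\<Gamma> n\<close> imposes a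
  weaker commutation condition. This is why the union over all finite-index subgroups is rewritten
  first.\<close>

lemma subgroup_stabilized_Aut:
  "subgroup (stabilized_Aut X G (left_action G \<Gamma>)) (HomeoGroup X)"
  unfolding stabilized_Aut_eq
proof (rule subgroup_UN_incseq)
  show "subgroup (Aut X (G\<lparr>carrier := \<Gamma> n\<rparr>) (left_action G \<Gamma>)) (HomeoGroup X)" for n
    using subgroup.mem_carrier[OF subgroup_level]
    by (intro subgroup_Aut) (auto simp: left_action_def intro!: mult_mem emb_mem)
  show "incseq (\<lambda>n. Aut X (G\<lparr>carrier := \<Gamma> n\<rparr>) (left_action G \<Gamma>))"
  proof (intro monoI subsetI)
    fix m n :: nat and f assume "m \<le> n" "f \<in> Aut X (G\<lparr>carrier := \<Gamma> m\<rparr>) (left_action G \<Gamma>)"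
    then show "f \<in> Aut X (G\<lparr>carrier := \<Gamma> n\<rparr>) (left_action G \<Gamma>)"
      using level_antimono[of m n] unfolding Aut_left_action_iff by blast
  qed
qed

end

theorem proposition4p7:
  fixes G :: "('a, 'b) monoid_scheme" and \<Gamma> :: "nat \<Rightarrow> 'a set"
  assumes "group G"
    and "countable (carrier G)"
    and "infinite (carrier G)"
    and "residually_finite G"
    and "scale G \<Gamma>"
  defines "X \<equiv> odometer_topology G \<Gamma>"
  shows "subgroup (stabilized_Aut X G (left_action G \<Gamma>)) (HomeoGroup X) \<and>
    stabilized_Aut X G (left_action G \<Gamma>) =
      (\<Union>n. Aut X (G\<lparr>carrier := \<Gamma> n\<rparr>) (left_action G \<Gamma>)) \<and>
    (\<Union>n. Aut X (G\<lparr>carrier := \<Gamma> n\<rparr>) (left_action G \<Gamma>)) =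
      (\<Union>n. Abstract_Topology.closure_of (uniform_topology X (odometer_metric G \<Gamma>))
              (right_full_group_level G \<Gamma> n)) \<and>
    (\<Union>n. Abstract_Topology.closure_of (uniform_topology X (odometer_metric G \<Gamma>))
              (right_full_group_level G \<Gamma> n)) =
      topological_full_group X (odometer G \<Gamma>) (right_translation G \<Gamma>)"
proof -
  interpret S: scaled_group G \<Gamma>
    using assms by (simp add: scaled_group_def scaled_group_axioms_def)
  \<comment> \<open>Being a subgroup is stated for the first of the four sets; the equalities carry
    it to the others.\<close>
  show ?thesis
    unfolding X_def
    by (intro conjI S.subgroup_stabilized_Aut S.stabilized_Aut_eq)
      (simp_all only: S.closure_right_full_group_level S.Union_Aut_level_eq_full_group)
qed

end
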